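(* Let $1\le m\le n$, let $q$ be a prime power, and run the ARCNC algorithm over $\mathbb{F}_q$ on the $\binom{n}{m}$ combination network, which has $d=\binom{n}{m}$ sinks with stopping times $T_1,\dots,T_d$. Let $T=\frac1d\sum_{i=1}^dT_i$. Then for every sink $i$, $$E[T]=E[T_i]=\sum_{t=1}^{\infty}P(T_i\ge t)<\sum_{t=1}^{\infty}\left(1-\left(1-\frac{1}{q^{t}}\right)^{m}\right)=\sum_{k=1}^{m}(-1)^{k-1}\binom{m}{k}\frac{1}{q^k-1}.$$
   Context: The $\binom{n}{m}$ combination network has a single source $s$ with one unit-capacity channel to each of $n$ intermediate nodes, and $d=\binom{n}{m}$ sinks. Each sink is connected by unit-capacity channels to a distinct $m$-element subset of the intermediate nodes, so the sinks correspond bijectively to the $m$-subsets. The source multicasts messages in $\mathbb{F}_q^m$, one per unit time. Only the source codes; intermediate nodes relay what they receive. ARCNC on this network: at each time $t=0,1,2,\dots$ the source uses an $m\times n$ local encoding kernel matrix $K_s(z)$ whose columns correspond to the intermediate nodes and whose entries are polynomials $\sum_{j=0}^{t}k_jz^j$ over $\mathbb{F}_q$. At time $t$ the coefficient of $z^t$ in each entry is chosen independently and uniformly at random from $\mathbb{F}_q$, except that a column stops growing (its later coefficients are set to $0$) once all sinks connected to the corresponding intermediate node can decode. The global encoding kernel matrix of a sink at time $t$ is the $m\times m$ submatrix of $K_s(z)$ formed by the columns of its $m$ parents. The sink can decode when this matrix has full rank $m$, i.e. its determinant is a nonzero polynomial. The stopping time $T_i$ of sink $i$ is the first time $t\ge0$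 at which sink $i$ can decode.
   Formalization: The strict inequality is stated only for m ≥ 2; for m = 1 it fails, since P(T_i ≥ t) = q^{-t} makes both sums equal to 1/(q−1), and equality is stated and proved there instead. *)

theory Defs
  imports
    "HOL-Probability.Probability"
    "Jordan_Normal_Form.Determinant"
    "Jordan_Normal_Form.DL_Submatrix"
begin

text \<open>
  The intermediate nodes of the combination network are \<open>0, \<dots>, n - 1\<close>; a sink is identified with
  the set of its \<open>m\<close> parents.
\<close>

definition sinks :: "nat \<Rightarrow> nat \<Rightarrow> nat set set" where
  "sinks m n = {S. S \<subseteq> {..<n} \<and> card S = m}"

definition sink_kernel :: "'a::field poly mat \<Rightarrow> nat set \<Rightarrow> 'a poly mat" where
  "sink_kernel K S = submatrix K UNIV S"

definition can_decode :: "'a::field poly mat \<Rightarrow> nat set \<Rightarrow> bool" where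
  "can_decode K S \<longleftrightarrow> Determinant.det (sink_kernel K S) \<noteq> 0"

text \<open>
  The argument \<open>k\<close> is a realisation of the random draws: \<open>k t i j\<close> is the draw made at time \<open>t\<close> for
  entry \<open>(i, j)\<close>.  It is used only if column \<open>j\<close> is still growing at time \<open>t\<close>.

  Once a sink has been able to decode, it stays in \<^term>\<open>decoded m n k t\<close>, even though its kernel
  matrix may still change afterwards (a parent can keep growing because of other sinks) and may
  even become singular again.  So a column that has stopped never resumes.
\<close>

fun source_kernel :: "nat \<Rightarrow> nat \<Rightarrow> (nat \<Rightarrow> nat \<Rightarrow> nat \<Rightarrow> 'a::field) \<Rightarrow> nat \<Rightarrow> 'a poly mat"
  and decoded :: "nat \<Rightarrow> nat \<Rightarrow> (nat \<Rightarrow> nat \<Rightarrow> nat \<Rightarrow> 'a::field) \<Rightarrow> nat \<Rightarrow> nat set set" where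
  "source_kernel m n k 0 = mat m n (\<lambda>(i, j). [:k 0 i j:])"
| "source_kernel m n k (Suc t) = mat m n (\<lambda>(i, j). source_kernel m n k t $$ (i, j) +
     (if \<forall>S\<in>sinks m n. j \<in> S \<longrightarrow> S \<in> decoded m n k t then 0
      else monom (k (Suc t) i j) (Suc t)))"
| "decoded m n k 0 = {S \<in> sinks m n. can_decode (source_kernel m n k 0) S}"
| "decoded m n k (Suc t) =
     decoded m n k t \<union> {S \<in> sinks m n. can_decode (source_kernel m n k (Suc t)) S}"

text \<open>The stopping time is \<open>\<infinity>\<close> if the sink is never able to decode.\<close>

definition decoding_time ::
    "nat \<Rightarrow> nat \<Rightarrow> (nat \<Rightarrow> nat \<Rightarrow> nat \<Rightarrow> 'a::field) \<Rightarrow> nat set \<Rightarrow> enat" where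
  "decoding_time m n k S = Inf (enat ` {t. can_decode (source_kernel m n k t) S})"

definition mean_decoding_time :: "nat \<Rightarrow> nat \<Rightarrow> (nat \<Rightarrow> nat \<Rightarrow> nat \<Rightarrow> 'a::field) \<Rightarrow> ennreal" where
  "mean_decoding_time m n k =
     (\<Sum>S\<in>sinks m n. ennreal_of_enat (decoding_time m n k S)) / of_nat (n choose m)"

end

theory Submission
  imports Defs
begin

text \<open>
  As long as a sink has not decoded, none of its columns stops growing.  So \<open>T\<^sub>i \<ge> t + 1\<close> is an event
  about the uniform coefficients of an \<open>m \<times> m\<close> matrix in which no column is ever stopped, and its
  probability is the same for all sinks.  It is contained in the event that this matrix is singular
  at time \<open>t\<close>, when its entries are independent and uniform among the \<open>q\<^bsup>t+1\<^esup>\<close> polynomials of degree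
  at most \<open>t\<close>.  If independent uniform entries are taken from a \<open>Q\<close>-element subset of an integral
  domain, the determinant is affine in the bottom right entry with the leading minor as slope, so
  induction on \<open>m\<close> bounds the probability of nonsingularity from below by \<open>(1 - 1/Q)\<^bsup>m\<^esup>\<close>.  For
  \<open>m \<ge> 2\<close> the bound is strict since a nonsingular matrix can have a vanishing leading minor.
\<close>

section \<open>Counting nonsingular matrices with entries in a finite subset of an integral
  domain\<close>

text \<open>Expansion along the last column: its cofactors do not see that column, so only the
  corner terms differ, and the corner cofactor is the leading minor.\<close>

lemma det_mat_bottom_right:
  fixes f g :: "nat \<times> nat \<Rightarrow> 'a::comm_ring_1"
  assumes "\<And>x. x \<noteq> (m, m) \<Longrightarrow> f x = g x"
  shows "Determinant.det (mat (Suc m) (Suc m) f) - Determinant.det (mat (Suc m) (Suc m) g)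
           = (f (m, m) - g (m, m)) * Determinant.det (mat m m g)"
proof -
  let ?F = "mat (Suc m) (Suc m) f" and ?G = "mat (Suc m) (Suc m) g"
  have cof: "cofactor ?F i m = cofactor ?G i m" if "i < Suc m" for i
  proof -
    have "mat_delete ?F i m = mat_delete ?G i m"
      by (rule eq_matI) (auto simp: mat_delete_def intro!: assms)
    then show ?thesis
      by (simp add: cofactor_def)
  qed
  have corner: "cofactor ?G m m = Determinant.det (mat m m g)"
  proof -
    have "mat_delete ?G m m = mat m m g"
      by (rule eq_matI) (auto simp: mat_delete_def)
    then show ?thesis
      by (simp add: cofactor_def)
  qed
  have F: "Determinant.det ?F = (\<Sum>i<Suc m. f (i, m) * cofactor ?F i m)"
    by (subst laplace_expansion_column[of _ "Suc m" m]) auto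
  have G: "Determinant.det ?G = (\<Sum>i<Suc m. g (i, m) * cofactor ?G i m)"
    by (subst laplace_expansion_column[of _ "Suc m" m]) auto
  have "Determinant.det ?F = (\<Sum>i<m. g (i, m) * cofactor ?G i m) + f (m, m) * cofactor ?G m m"
    unfolding F using assms by (simp add: cof)
  moreover have "Determinant.det ?G = (\<Sum>i<m. g (i, m) * cofactor ?G i m) + g (m, m) * cofactor ?G m m"
    unfolding G by simp
  ultimately show ?thesis
    by (simp add: corner algebra_simps)
qed

text \<open>Two corner values \<open>a\<close>, \<open>b\<close> with vanishing determinant would
  make \<open>(a - b)\<close> times the leading minor zero, so in an integral domain at most one
  value is lost.\<close>

lemma card_bottom_right_det_nonzero:
  fixes g :: "nat \<times> nat \<Rightarrow> 'a::idom"
  assumes "finite A" and "Determinant.det (mat m m g) \<noteq> 0"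
  shows "card A - 1 \<le> card {a \<in> A. Determinant.det (mat (Suc m) (Suc m) (g((m, m) := a))) \<noteq> 0}"
proof -
  let ?d = "\<lambda>a. Determinant.det (mat (Suc m) (Suc m) (g((m, m) := a)))"
  have inj: "a = b" if "?d a = 0" "?d b = 0" for a b
  proof -
    have "mat m m (g((m, m) := b)) = mat m m g"
      by (rule eq_matI) auto
    then show ?thesis
      using det_mat_bottom_right[of m "g((m, m) := a)" "g((m, m) := b)"] that assms(2) by simp
  qed
  have "card {a \<in> A. ?d a = 0} \<le> 1"
  proof (cases "\<exists>b. ?d b = 0")
    case True
    then obtain b where "?d b = 0" ..
    then have "{a \<in> A. ?d a = 0} \<subseteq> {b}"
      using inj by blast
    then show ?thesis
      using card_mono[of "{b}"] by simp
  qed simp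
  moreover have "card A = card {a \<in> A. ?d a = 0} + card {a \<in> A. ?d a \<noteq> 0}"
    using assms(1) by (subst card_Un_disjoint[symmetric]) (auto intro!: arg_cong[of _ _ card])
  ultimately show ?thesis
    by simp
qed

text \<open>Matrices are encoded as extensional functions on the index grid, so that they can be
  counted as elements of a finite function space. The set \<open>A\<close> need not be closed under
  the ring operations; later it consists of the polynomials of degree at most
  \<open>t\<close>.\<close>

definition nonsingular :: "'a::idom set \<Rightarrow> nat \<Rightarrow> (nat \<times> nat \<Rightarrow> 'a) set" where
  "nonsingular A m =
     {f \<in> ({..<m} \<times> {..<m}) \<rightarrow>\<^sub>E A. Determinant.det (mat m m f) \<noteq> 0}"

lemma finite_nonsingular: "finite A \<Longrightarrow> finite (nonsingular A m)"
  unfolding nonsingular_def by (rule finite_subset[OF Collect_subset]) (auto intro!: finite_PiE)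

text \<open>The witness is the identity with rows \<open>0\<close> and \<open>m\<close> swapped: the
  only 1 of row \<open>0\<close> moves to column \<open>m\<close>, which leaves a zero row in the
  leading block.\<close>

lemma nonsingular_swap:
  fixes A :: "'a::idom set"
  assumes "0 \<in> A" "1 \<in> A" "1 \<le> m"
  shows "\<exists>f\<in>nonsingular A (Suc m). Determinant.det (mat m m f) = 0"
proof -
  let ?P = "swaprows 0 m (1\<^sub>m (Suc m)) :: 'a mat"
  define f where "f = (\<lambda>x\<in>{..<Suc m} \<times> {..<Suc m}. ?P $$ x)"
  have eq: "mat (Suc m) (Suc m) f = ?P"
    by (rule eq_matI) (auto simp: f_def)
  have "Determinant.det ?P \<noteq> 0"
    using assms by (subst det_swaprows[of _ "Suc m"]) auto
  moreover have "f x \<in> A" if "x \<in> {..<Suc m} \<times> {..<Suc m}" for x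
    using that assms by (auto simp: f_def mat_swaprows_def)
  moreover have "f x = undefined" if "x \<notin> {..<Suc m} \<times> {..<Suc m}" for x
    using that by (auto simp: f_def)
  ultimately have "f \<in> nonsingular A (Suc m)"
    unfolding nonsingular_def mem_Collect_eq eq by (intro conjI PiE_I)
  moreover have "Determinant.det (mat m m f) = 0"
    using assms
    by (subst laplace_expansion_row[of _ m 0]) (auto simp: f_def mat_swaprows_def)
  ultimately show ?thesis
    by blast
qed

text \<open>The extra \<open>1\<close> counts a transposition, which is not among the extensions of a nonsingular
  leading minor.\<close>

lemma card_nonsingular_Suc:
  fixes A :: "'a::idom set"
  assumes fin: "finite A"
  shows "card (nonsingular A m) * card A ^ (2 * m) * (card A - 1)
           + of_bool (0 \<in> A \<and> 1 \<in> A \<and> 1 \<le> m) \<le> card (nonsingular A (Suc m))"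
proof -
  let ?D = "{..<Suc m} \<times> {..<Suc m}" and ?E = "{..<m} \<times> {..<m}"
  \<comment> \<open>The border: last row and last column without the corner.\<close>
  define L where "L = ?D - insert (m, m) ?E"
  have finL: "finite L"
    unfolding L_def by (intro finite_Diff) auto
  have cardL: "card L = 2 * m"
  proof -
    have "L = {..<m} \<times> {m} \<union> {m} \<times> {..<m}"
      by (auto simp: L_def less_Suc_eq simp del: lessThan_Suc)
    then show ?thesis
      by (simp add: card_Un_disjoint Times_Int_Times card_cartesian_product)
  qed
  \<comment> \<open>At the corner, \<open>glue\<close> has only a placeholder value, overwritten in
    \<open>good\<close> and \<open>\<Phi>\<close>. Off \<open>?D\<close> it inherits
    \<open>undefined\<close> from the extensional \<open>l\<close>, as membership in
    \<open>nonsingular\<close> demands.\<close>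
  define glue :: "(nat \<times> nat \<Rightarrow> 'a) \<times> (nat \<times> nat \<Rightarrow> 'a) \<Rightarrow> nat \<times> nat \<Rightarrow> 'a"
    where "glue = (\<lambda>(g, l) x. if x \<in> ?E then g x else l x)"
  define good where "good p =
    {a \<in> A. Determinant.det (mat (Suc m) (Suc m) ((glue p)((m, m) := a))) \<noteq> 0}" for p
  define B where "B = nonsingular A m \<times> (L \<rightarrow>\<^sub>E A)"
  define \<Phi> :: "((nat \<times> nat \<Rightarrow> 'a) \<times> (nat \<times> nat \<Rightarrow> 'a)) \<times> 'a \<Rightarrow> nat \<times> nat \<Rightarrow> 'a"
    where "\<Phi> = (\<lambda>(p, a). (glue p)((m, m) := a))"
  have finB: "finite B"
    unfolding B_def by (intro finite_cartesian_product finite_nonsingular finite_PiE fin finL)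
  have mat_glue: "mat m m (glue (g, l)) = mat m m g" for g l
    by (rule eq_matI) (auto simp: glue_def)
  have mat_glue_upd: "mat m m ((glue (g, l))((m, m) := a)) = mat m m g" for g l a
    by (rule eq_matI) (auto simp: glue_def)
  have good: "card A - 1 \<le> card (good p)" if "p \<in> B" for p
    using that unfolding good_def
    by (intro card_bottom_right_det_nonzero[OF fin])
       (auto simp: B_def nonsingular_def mat_glue split: prod.splits)
  have inj: "inj_on \<Phi> (Sigma B good)"
  proof (rule inj_onI)
    fix u v
    assume uv: "u \<in> Sigma B good" "v \<in> Sigma B good" "\<Phi> u = \<Phi> v"
    obtain g l a g' l' a' where u: "u = ((g, l), a)" and v: "v = ((g', l'), a')"
      by (metis surj_pair)
    have "(g, l) \<in> B" "(g', l') \<in> B" and eq: "\<Phi> ((g, l), a) = \<Phi> ((g', l'), a')"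
      using uv by (auto simp: u v)
    then have ext: "g \<in> ?E \<rightarrow>\<^sub>E A" "g' \<in> ?E \<rightarrow>\<^sub>E A" "l \<in> L \<rightarrow>\<^sub>E A" "l' \<in> L \<rightarrow>\<^sub>E A"
      by (auto simp: B_def nonsingular_def)
    have val: "((glue (g, l))((m, m) := a)) x = ((glue (g', l'))((m, m) := a')) x" for x
      using fun_cong[OF eq, of x] by (simp add: \<Phi>_def)
    have "a = a'"
      using val[of "(m, m)"] by simp
    moreover have "g x = g' x" if "x \<in> ?E" for x
      using val[of x] that by (auto simp: glue_def)
    then have "g = g'"
      using PiE_ext[OF ext(1,2)] by blast
    moreover have "l x = l' x" if "x \<in> L" for x
    proof -
      have "x \<noteq> (m, m)" "x \<notin> ?E"
        using that by (auto simp: L_def)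
      then show ?thesis
        using val[of x] by (simp add: glue_def)
    qed
    then have "l = l'"
      using PiE_ext[OF ext(3,4)] by blast
    ultimately show "u = v"
      by (simp add: u v)
  qed
  have sub: "\<Phi> ` Sigma B good \<subseteq> nonsingular A (Suc m)"
  proof clarify
    fix g l a
    assume B: "(g, l) \<in> B" and a: "a \<in> good (g, l)"
    have "((glue (g, l))((m, m) := a)) \<in> ?D \<rightarrow>\<^sub>E A"
    proof (rule PiE_I)
      fix x assume "x \<in> ?D"
      then consider "x = (m, m)" | "x \<noteq> (m, m)" "x \<in> ?E" | "x \<noteq> (m, m)" "x \<notin> ?E" "x \<in> L"
        by (auto simp: L_def)
      then show "((glue (g, l))((m, m) := a)) x \<in> A"
        using B a by cases (auto simp: good_def B_def nonsingular_def glue_def)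
    next
      fix x assume "x \<notin> ?D"
      then have "x \<noteq> (m, m)" "x \<notin> ?E" "x \<notin> L"
        by (auto simp: L_def)
      then show "((glue (g, l))((m, m) := a)) x = undefined"
        using B PiE_arb[of l L "\<lambda>_. A" x] by (simp add: B_def glue_def)
    qed
    then show "\<Phi> ((g, l), a) \<in> nonsingular A (Suc m)"
      using a by (simp add: nonsingular_def \<Phi>_def good_def)
  qed
  have minor: "Determinant.det (mat m m f) \<noteq> 0" if "f \<in> \<Phi> ` Sigma B good" for f
    using that by (auto simp: \<Phi>_def mat_glue_upd B_def nonsingular_def simp del: fun_upd_apply)
  have "card (nonsingular A m) * card A ^ (2 * m) * (card A - 1) = (\<Sum>p\<in>B. card A - 1)"
    using finL by (simp add: B_def card_cartesian_product card_PiE cardL)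
  also have "\<dots> \<le> (\<Sum>p\<in>B. card (good p))"
    by (intro sum_mono good)
  also have "\<dots> = card (Sigma B good)"
    using finB fin by (subst card_SigmaI) (auto simp: good_def)
  also have "\<dots> = card (\<Phi> ` Sigma B good)"
    by (rule card_image[OF inj, symmetric])
  finally have le: "card (nonsingular A m) * card A ^ (2 * m) * (card A - 1)
      \<le> card (\<Phi> ` Sigma B good)" .
  show ?thesis
  proof (cases "0 \<in> A \<and> 1 \<in> A \<and> 1 \<le> m")
    case True
    then obtain f where "f \<in> nonsingular A (Suc m)" "Determinant.det (mat m m f) = 0"
      using nonsingular_swap[of A m] by blast
    then have "\<Phi> ` Sigma B good \<subset> nonsingular A (Suc m)"
      using sub minor by blast
    then have "card (\<Phi> ` Sigma B good) < card (nonsingular A (Suc m))"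
      using fin by (intro psubset_card_mono finite_nonsingular)
    then show ?thesis
      using le True by simp
  next
    case False
    have "card (\<Phi> ` Sigma B good) \<le> card (nonsingular A (Suc m))"
      using fin sub by (intro card_mono finite_nonsingular)
    then show ?thesis
      using le False by auto
  qed
qed

text \<open>For \<open>r = 1 - 1 / Q\<close>, the bound for size \<open>Suc m\<close> is the bound
  for \<open>m\<close>, times \<open>Q ^ (2 * m)\<close> borders, times \<open>Q * r = Q - 1\<close>
  corners.\<close>

lemma power_Suc_square:
  fixes Q r :: "'a::comm_semiring_1"
  shows "Q ^ (Suc m * Suc m) * r ^ Suc m = Q ^ (m * m) * r ^ m * (Q ^ (2 * m) * (Q * r))"
proof -
  have "Suc m * Suc m = m * m + 2 * m + 1"
    by simp
  then show ?thesis
    by (simp only: power_add power_Suc power_one_right mult_ac)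
qed

text \<open>The \<open>of_bool\<close> term is carried along so that one induction step serves both
  the weak and the strict bound.\<close>

lemma card_nonsingular_ge_Suc:
  fixes A :: "'a::idom set"
  assumes "finite A" "A \<noteq> {}"
    and IH: "real (card A) ^ (m * m) * (1 - 1 / card A) ^ m \<le> card (nonsingular A m)"
  shows "real (card A) ^ (Suc m * Suc m) * (1 - 1 / card A) ^ Suc m
           + of_bool (0 \<in> A \<and> 1 \<in> A \<and> 1 \<le> m) \<le> card (nonsingular A (Suc m))"
proof -
  define Q where "Q = real (card A)"
  have Q: "Q \<ge> 1"
    using assms by (simp add: Q_def Suc_le_eq card_gt_0_iff)
  have "Q ^ (Suc m * Suc m) * (1 - 1 / Q) ^ Suc m
      = Q ^ (m * m) * (1 - 1 / Q) ^ m * (Q ^ (2 * m) * (Q * (1 - 1 / Q)))"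
    by (rule power_Suc_square)
  also have "Q * (1 - 1 / Q) = Q - 1"
    using Q by (simp add: field_simps)
  also have "Q ^ (m * m) * (1 - 1 / Q) ^ m * (Q ^ (2 * m) * (Q - 1))
      \<le> card (nonsingular A m) * (Q ^ (2 * m) * (Q - 1))"
    using IH Q by (intro mult_right_mono) (auto simp: Q_def)
  also have "\<dots> = real (card (nonsingular A m) * card A ^ (2 * m) * (card A - 1))"
    using Q by (simp add: Q_def of_nat_diff)
  finally have "Q ^ (Suc m * Suc m) * (1 - 1 / Q) ^ Suc m
      + real (of_bool (0 \<in> A \<and> 1 \<in> A \<and> 1 \<le> m)) \<le> real (card (nonsingular A m)
      * card A ^ (2 * m) * (card A - 1) + of_bool (0 \<in> A \<and> 1 \<in> A \<and> 1 \<le> m))"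
    by (simp only: of_nat_add add_le_cancel_right)
  also have "\<dots> \<le> card (nonsingular A (Suc m))"
    using card_nonsingular_Suc[OF assms(1), of m] by (simp only: of_nat_le_iff)
  finally show ?thesis
    by (simp only: Q_def of_nat_of_bool)
qed

lemma card_nonsingular_ge:
  fixes A :: "'a::idom set"
  assumes "finite A" "A \<noteq> {}"
  shows "real (card A) ^ (m * m) * (1 - 1 / card A) ^ m \<le> card (nonsingular A m)"
proof (induction m)
  case 0
  \<comment> \<open>The empty matrix has determinant 1.\<close>
  have "nonsingular A 0 = {\<lambda>_. undefined}"
    by (auto simp: nonsingular_def)
  then show ?case
    by simp
next
  case (Suc m)
  have "x \<le> y" if "x + of_bool b \<le> y" for x y :: real and b
    using that by (cases b) auto
  from this[OF card_nonsingular_ge_Suc[OF assms Suc]] show ?case .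
qed

text \<open>Strictness is gained in the last step, from \<open>m - 1\<close> to \<open>m\<close>;
  the weak bound suffices below it.\<close>

lemma card_nonsingular_gt:
  fixes A :: "'a::idom set"
  assumes "finite A" "0 \<in> A" "1 \<in> A" "2 \<le> m"
  shows "real (card A) ^ (m * m) * (1 - 1 / card A) ^ m < card (nonsingular A m)"
proof -
  obtain k where k: "m = Suc k" "1 \<le> k"
    using assms(4) by (cases m) auto
  have "A \<noteq> {}"
    using assms(2) by auto
  have strict: "x < y" if "x + of_bool b \<le> y" b for x y :: real and b
    using that by auto
  show ?thesis
    unfolding k(1)
    by (rule strict[OF card_nonsingular_ge_Suc[OF assms(1) \<open>A \<noteq> {}\<close>
          card_nonsingular_ge[OF assms(1) \<open>A \<noteq> {}\<close>]]])
      (use assms(2,3) k(2) in blast)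
qed

section \<open>Replacing the sink kernel by a matrix whose columns never stop\<close>

definition ungated_kernel :: "nat \<Rightarrow> (nat \<times> nat \<times> nat \<Rightarrow> 'a::field) \<Rightarrow> nat \<Rightarrow> 'a poly mat" where
  "ungated_kernel m f t = mat m m (\<lambda>x. \<Sum>s\<le>t. monom (f (s, x)) s)"

text \<open>Singularity at time \<open>t\<close> alone would be a weaker condition: rows
  \<open>(1, z)\<close>, \<open>(z, 0)\<close> are nonsingular at time 1, but adding
  \<open>z^2\<close> to the last entry at time 2 makes the matrix singular again.\<close>

definition stuck :: "nat \<Rightarrow> nat \<Rightarrow> (nat \<times> nat \<times> nat \<Rightarrow> 'a::field) set" where
  "stuck m t = {f \<in> ({..t} \<times> {..<m} \<times> {..<m}) \<rightarrow>\<^sub>E UNIV.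
     \<forall>t'\<le>t. Determinant.det (ungated_kernel m f t') = 0}"

lemma ungated_kernel_cong:
  assumes "\<And>s i j. s \<le> t \<Longrightarrow> i < m \<Longrightarrow> j < m \<Longrightarrow> f (s, i, j) = g (s, i, j)"
  shows "ungated_kernel m f t = ungated_kernel m g t"
  by (rule eq_matI) (auto simp: ungated_kernel_def assms)

lemma source_kernel_carrier: "source_kernel m n k t \<in> carrier_mat m n"
  by (cases t) auto

lemma sink_kernel_eq:
  assumes "K \<in> carrier_mat m n" "S \<in> sinks m n"
  shows "sink_kernel K S = mat m m (\<lambda>(i, j). K $$ (i, pick S j))"
proof -
  have "{j. j < n \<and> j \<in> S} = S" "card S = m"
    using assms(2) by (auto simp: sinks_def)
  then show ?thesis
    using assms(1) by (simp add: sink_kernel_def submatrix_def pick_UNIV)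
qed

lemma not_decoded:
  assumes "\<forall>t'\<le>t. \<not> can_decode (source_kernel m n k t') S"
  shows "S \<notin> decoded m n k t"
  using assms by (induction t) (auto simp del: source_kernel.simps)

text \<open>The undecoded sink \<open>S\<close> itself refutes the stopping condition of each of its
  columns. The draw at time \<open>t\<close> is still used, because stopping at \<open>t\<close>
  depends only on decoding before \<open>t\<close>.\<close>

lemma source_kernel_before_decoding:
  assumes "S \<in> sinks m n" "j \<in> S" "i < m"
    and "\<forall>t'<t. \<not> can_decode (source_kernel m n k t') S"
  shows "source_kernel m n k t $$ (i, j) = (\<Sum>s\<le>t. monom (k s i j) s)"
  using assms(4)
proof (induction t)
  case 0
  then show ?case
    using assms(1-3) by (auto simp: sinks_def monom_0)
next
  case (Suc t)
  have "S \<notin> decoded m n k t"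
    using Suc.prems by (intro not_decoded) auto
  moreover have "source_kernel m n k t $$ (i, j) = (\<Sum>s\<le>t. monom (k s i j) s)"
    using Suc by simp
  moreover have "j < n"
    using assms(1,2) by (auto simp: sinks_def)
  ultimately show ?case
    using assms(1-3) by auto
qed

lemma sink_kernel_before_decoding:
  assumes "S \<in> sinks m n" and "\<forall>t'<t. \<not> can_decode (source_kernel m n k t') S"
  shows "sink_kernel (source_kernel m n k t) S = ungated_kernel m (\<lambda>(s, i, j). k s i (pick S j)) t"
proof -
  have "pick S j \<in> S" if "j < m" for j
    using that assms(1) by (intro pick_in_set_le) (simp add: sinks_def)
  then show ?thesis
    unfolding sink_kernel_eq[OF source_kernel_carrier assms(1)] ungated_kernel_def
    by (intro eq_matI) (auto simp: source_kernel_before_decoding[OF assms(1) _ _ assms(2)])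
qed

text \<open>Up to and including the first decoding time the two kernels agree. They may differ
  afterwards, but by then both sides are false.\<close>

lemma never_decoded_iff:
  assumes S: "S \<in> sinks m n"
  shows "(\<forall>t'<t. \<not> can_decode (source_kernel m n k t') S) \<longleftrightarrow>
    (\<forall>t'<t. Determinant.det (ungated_kernel m (\<lambda>(s, i, j). k s i (pick S j)) t') = 0)"
proof (induction t)
  case (Suc t)
  show ?case
    using Suc sink_kernel_before_decoding[OF S, of t k]
    by (auto simp: All_less_Suc can_decode_def simp del: source_kernel.simps)
qed simp

lemma Suc_le_decoding_time_iff:
  "enat (Suc t) \<le> decoding_time m n k S \<longleftrightarrow>
     (\<forall>t'<Suc t. \<not> can_decode (source_kernel m n k t') S)"
proof -
  have "enat (Suc t) \<le> decoding_time m n k S \<longleftrightarrow>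
      (\<forall>t'. can_decode (source_kernel m n k t') S \<longrightarrow> Suc t \<le> t')"
    by (simp add: decoding_time_def le_Inf_iff)
  then show ?thesis
    using not_le by blast
qed

text \<open>The event becomes membership of finitely many draws in a set that does not depend on
  \<open>S\<close>; the sink only selects which draws are read.\<close>

lemma Suc_le_decoding_time_iff_stuck:
  assumes "S \<in> sinks m n"
  shows "enat (Suc t) \<le> decoding_time m n k S \<longleftrightarrow>
     (\<lambda>(s, i, j)\<in>{..t} \<times> {..<m} \<times> {..<m}. k s i (pick S j)) \<in> stuck m t"
proof -
  have "ungated_kernel m (\<lambda>(s, i, j)\<in>{..t} \<times> {..<m} \<times> {..<m}. k s i (pick S j)) t'
      = ungated_kernel m (\<lambda>(s, i, j). k s i (pick S j)) t'" if "t' \<le> t" for t'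
    using that by (intro ungated_kernel_cong) auto
  then show ?thesis
    unfolding Suc_le_decoding_time_iff never_decoded_iff[OF assms] stuck_def
    by (auto simp: less_Suc_eq_le)
qed

section \<open>Counting stuck coefficient families through polynomials of bounded degree\<close>

lemma coeff_sum_monom:
  "coeff (\<Sum>s\<le>t. monom (g s) s) r = (if r \<le> t then g r else 0)"
  by (simp add: coeff_sum)

lemma bij_betw_sum_monom:
  "bij_betw (\<lambda>g. \<Sum>s\<le>t. monom (g s) s) ({..t} \<rightarrow>\<^sub>E (UNIV :: 'a::comm_ring_1 set))
     {p. degree p \<le> t}"
proof (rule bij_betwI[where g = "\<lambda>p. \<lambda>s\<in>{..t}. coeff p s"])
  show "(\<lambda>g. \<Sum>s\<le>t. monom (g s) s) \<in> ({..t} \<rightarrow>\<^sub>E UNIV) \<rightarrow> {p :: 'a poly. degree p \<le> t}"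
    by (auto intro!: degree_le simp: coeff_sum_monom)
  show "(\<lambda>p. \<lambda>s\<in>{..t}. coeff p s) \<in> {p :: 'a poly. degree p \<le> t} \<rightarrow> {..t} \<rightarrow>\<^sub>E UNIV"
    by auto
  show "(\<lambda>s\<in>{..t}. coeff (\<Sum>s\<le>t. monom (g s) s) s) = g" if "g \<in> {..t} \<rightarrow>\<^sub>E UNIV" for g :: "nat \<Rightarrow> 'a"
    using that by (auto simp: coeff_sum_monom fun_eq_iff PiE_def extensional_def)
  show "(\<Sum>s\<le>t. monom ((\<lambda>s\<in>{..t}. coeff p s) s) s) = p" if "p \<in> {p. degree p \<le> t}" for p :: "'a poly"
    using that poly_as_sum_of_monoms'[of p t] by simp
qed

lemma finite_degree_le: "finite {p :: 'a::{comm_ring_1, finite} poly. degree p \<le> t}"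
proof -
  have "finite ({..t} \<rightarrow>\<^sub>E (UNIV :: 'a set))"
    by (intro finite_PiE) auto
  then show ?thesis
    using bij_betw_finite[OF bij_betw_sum_monom[of t, where ?'a = 'a]] by blast
qed

lemma card_degree_le:
  "card {p :: 'a::{comm_ring_1, finite} poly. degree p \<le> t} = CARD('a) ^ Suc t"
  by (simp add: bij_betw_same_card[OF bij_betw_sum_monom, symmetric] card_PiE)

text \<open>Collecting coefficients into polynomials injects the stuck families into the singular
  matrices over polynomials of degree at most \<open>t\<close>. Stating this as a sum avoids
  truncated subtraction.\<close>

lemma card_stuck_add_card_nonsingular:
  "card (stuck m t :: (nat \<times> nat \<times> nat \<Rightarrow> 'a::{field, finite}) set)
     + card (nonsingular {p :: 'a poly. degree p \<le> t} m) \<le> (CARD('a) ^ Suc t) ^ (m * m)"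
proof -
  let ?A = "{p :: 'a poly. degree p \<le> t}" and ?I = "{..<m} \<times> {..<m}"
  define \<Psi> :: "(nat \<times> nat \<times> nat \<Rightarrow> 'a) \<Rightarrow> nat \<times> nat \<Rightarrow> 'a poly"
    where "\<Psi> f = (\<lambda>x\<in>?I. \<Sum>s\<le>t. monom (f (s, x)) s)" for f
  have fin: "finite (?I \<rightarrow>\<^sub>E ?A)"
    by (intro finite_PiE finite_degree_le) auto
  have ns: "nonsingular ?A m \<subseteq> ?I \<rightarrow>\<^sub>E ?A"
    by (auto simp: nonsingular_def)
  have "inj_on \<Psi> (({..t} \<times> ?I) \<rightarrow>\<^sub>E UNIV)"
  proof (rule inj_onI)
    fix f g :: "nat \<times> nat \<times> nat \<Rightarrow> 'a"
    assume fg: "f \<in> ({..t} \<times> ?I) \<rightarrow>\<^sub>E UNIV" "g \<in> ({..t} \<times> ?I) \<rightarrow>\<^sub>E UNIV" and eq: "\<Psi> f = \<Psi> g"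
    show "f = g"
    proof (rule PiE_ext[OF fg])
      fix y assume "y \<in> {..t} \<times> ?I"
      then obtain s x where y: "y = (s, x)" "s \<le> t" "x \<in> ?I"
        by auto
      have "coeff (\<Psi> f x) s = coeff (\<Psi> g x) s"
        by (simp add: eq)
      then show "f y = g y"
        using y by (simp add: \<Psi>_def coeff_sum_monom)
    qed
  qed
  then have inj: "inj_on \<Psi> (stuck m t)"
    by (rule inj_on_subset) (auto simp: stuck_def)
  have "\<Psi> ` stuck m t \<subseteq> (?I \<rightarrow>\<^sub>E ?A) - nonsingular ?A m"
  proof clarify
    fix f :: "nat \<times> nat \<times> nat \<Rightarrow> 'a"
    assume f: "f \<in> stuck m t"
    have "degree (\<Psi> f x) \<le> t" if "x \<in> ?I" for x
      using that by (intro degree_le) (auto simp: \<Psi>_def coeff_sum_monom)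
    then have "\<Psi> f \<in> ?I \<rightarrow>\<^sub>E ?A"
      by (auto simp: \<Psi>_def)
    moreover have "mat m m (\<Psi> f) = ungated_kernel m f t"
      by (rule eq_matI) (auto simp: \<Psi>_def ungated_kernel_def)
    then have "\<Psi> f \<notin> nonsingular ?A m"
      using f by (auto simp: nonsingular_def stuck_def)
    ultimately show "\<Psi> f \<in> (?I \<rightarrow>\<^sub>E ?A) - nonsingular ?A m"
      by blast
  qed
  then have "card (stuck m t :: (nat \<times> nat \<times> nat \<Rightarrow> 'a) set) \<le> card ((?I \<rightarrow>\<^sub>E ?A) - nonsingular ?A m)"
    using fin by (intro card_inj_on_le[OF inj]) auto
  also have "\<dots> = (CARD('a) ^ Suc t) ^ (m * m) - card (nonsingular ?A m)"
    using card_Diff_subset[OF finite_subset[OF ns fin] ns]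
    by (simp add: card_PiE card_degree_le)
  finally show ?thesis
    using card_mono[OF fin ns] by (simp add: card_PiE card_degree_le)
qed

text \<open>The \<open>itself\<close> argument names the field, which the real value cannot reveal.
  The exponent stays a cardinality to match \<open>prob_uniform_family\<close>.\<close>

definition stuck_prob :: "'a::{field, finite} itself \<Rightarrow> nat \<Rightarrow> nat \<Rightarrow> real" where
  "stuck_prob _ m t = card (stuck m t :: (nat \<times> nat \<times> nat \<Rightarrow> 'a) set)
     / real CARD('a) ^ card ({..t} \<times> {..<m} \<times> {..<m})"

lemma CARD_field_ge_2: "2 \<le> CARD('a::{field, finite})"
proof -
  have "card {0, 1 :: 'a} \<le> CARD('a)"
    by (rule card_mono) auto
  then show ?thesis
    by simp
qed

lemma stuck_prob_denominator:
  "(x::real) ^ card ({..t} \<times> {..<m} \<times> {..<m}) = (x ^ Suc t) ^ (m * m)"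
  by (simp only: card_cartesian_product card_atMost card_lessThan power_mult)

lemma stuck_prob_add_nonsingular_le_1:
  "stuck_prob TYPE('a::{field, finite}) m t
     + card (nonsingular {p :: 'a poly. degree p \<le> t} m) / (real CARD('a) ^ Suc t) ^ (m * m) \<le> 1"
proof -
  have "real (card (stuck m t :: (nat \<times> nat \<times> nat \<Rightarrow> 'a) set)
      + card (nonsingular {p :: 'a poly. degree p \<le> t} m)) \<le> (real CARD('a) ^ Suc t) ^ (m * m)"
    unfolding of_nat_power[symmetric] of_nat_le_iff by (rule card_stuck_add_card_nonsingular)
  then show ?thesis
    unfolding stuck_prob_def stuck_prob_denominator add_divide_distrib[symmetric] of_nat_add
    by (subst pos_divide_le_eq) (auto simp del: power_Suc)
qed

lemma stuck_prob_le:
  "stuck_prob TYPE('a::{field, finite}) m t \<le> 1 - (1 - 1 / real CARD('a) ^ Suc t) ^ m"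
proof -
  let ?A = "{p :: 'a poly. degree p \<le> t}"
  have A: "finite ?A" "?A \<noteq> {}"
    by (auto intro: finite_degree_le exI[of _ 0])
  have card: "real (card ?A) = real CARD('a) ^ Suc t"
    by (simp only: card_degree_le of_nat_power)
  have "(1 - 1 / real CARD('a) ^ Suc t) ^ m
      \<le> card (nonsingular ?A m) / (real CARD('a) ^ Suc t) ^ (m * m)"
    using card_nonsingular_ge[OF A, of m] unfolding card
    by (subst pos_le_divide_eq) (auto simp: mult.commute simp del: power_Suc)
  then show ?thesis
    using stuck_prob_add_nonsingular_le_1[of m t, where ?'a = 'a] by linarith
qed

lemma stuck_prob_less:
  assumes "2 \<le> m"
  shows "stuck_prob TYPE('a::{field, finite}) m t < 1 - (1 - 1 / real CARD('a) ^ Suc t) ^ m"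
proof -
  let ?A = "{p :: 'a poly. degree p \<le> t}"
  have A: "finite ?A" "0 \<in> ?A" "1 \<in> ?A"
    by (auto intro: finite_degree_le)
  have card: "real (card ?A) = real CARD('a) ^ Suc t"
    by (simp only: card_degree_le of_nat_power)
  have "(1 - 1 / real CARD('a) ^ Suc t) ^ m
      < card (nonsingular ?A m) / (real CARD('a) ^ Suc t) ^ (m * m)"
    using card_nonsingular_gt[OF A assms] unfolding card
    by (subst pos_less_divide_eq) (auto simp: mult.commute simp del: power_Suc)
  then show ?thesis
    using stuck_prob_add_nonsingular_le_1[of m t, where ?'a = 'a] by linarith
qed

text \<open>The determinant is the single entry, so only the zero family is stuck. Hence the general
  bound is attained for \<open>m = 1\<close>.\<close>

lemma stuck_prob_1: "stuck_prob TYPE('a::{field, finite}) 1 t = 1 / real CARD('a) ^ Suc t"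
proof -
  let ?I = "{..t} \<times> {..<1::nat} \<times> {..<1::nat}"
  have det: "Determinant.det (ungated_kernel 1 f t') = (\<Sum>s\<le>t'. monom (f (s, 0, 0)) s)"
    for f :: "nat \<times> nat \<times> nat \<Rightarrow> 'a" and t'
    by (subst det_single) (auto simp: ungated_kernel_def)
  have "stuck 1 t = {\<lambda>x\<in>?I. 0 :: 'a}"
  proof (intro equalityI subsetI)
    fix f :: "nat \<times> nat \<times> nat \<Rightarrow> 'a" assume f: "f \<in> stuck 1 t"
    have "f (s, 0, 0) = 0" if "s \<le> t" for s
      using f coeff_sum_monom[of "\<lambda>s. f (s, 0, 0)" t s] that unfolding stuck_def det by simp
    then have "f = (\<lambda>x\<in>?I. 0)"
      using f by (intro PiE_ext[of f ?I "\<lambda>_. UNIV"]) (auto simp: stuck_def)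
    then show "f \<in> {\<lambda>x\<in>?I. 0}"
      by simp
  next
    have "Determinant.det (ungated_kernel 1 (\<lambda>x\<in>?I. 0 :: 'a) t') = 0" if "t' \<le> t" for t'
      unfolding det using that by (intro sum.neutral) auto
    then show "f \<in> stuck 1 t" if "f \<in> {\<lambda>x\<in>?I. 0 :: 'a}" for f
      using that by (auto simp: stuck_def)
  qed
  then show ?thesis
    by (simp add: stuck_prob_def stuck_prob_denominator del: power_Suc)
qed

section \<open>From counting to probabilities and series\<close>

text \<open>The event is a disjoint union over the values \<open>g\<close> in \<open>E\<close>, each
  of which has probability \<open>(1 / CARD('b)) ^ card I\<close> by independence. Injectivity of
  \<open>h\<close> ensures that no variable is read twice.\<close>

lemma (in prob_space) prob_uniform_family:
  fixes X :: "'i \<Rightarrow> 'a \<Rightarrow> 'b::finite" and h :: "'k \<Rightarrow> 'i"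
  assumes indep: "indep_vars (\<lambda>_. count_space UNIV) X J"
    and unif: "\<And>i. i \<in> J \<Longrightarrow> distr M (count_space UNIV) (X i) = uniform_count_measure UNIV"
    and I: "finite I" "I \<noteq> {}" and h: "inj_on h I" "h ` I \<subseteq> J"
    and E: "E \<subseteq> I \<rightarrow>\<^sub>E UNIV"
  shows "{\<omega> \<in> space M. (\<lambda>i\<in>I. X (h i) \<omega>) \<in> E} \<in> events"
    and "prob {\<omega> \<in> space M. (\<lambda>i\<in>I. X (h i) \<omega>) \<in> E} = card E / real CARD('b) ^ card I"
proof -
  have rv: "X i \<in> measurable M (count_space UNIV)" if "i \<in> J" for i
    using indep that by (auto simp: indep_vars_def2)
  have single: "prob (X i -` {b} \<inter> space M) = 1 / CARD('b)" if "i \<in> J" for i b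
  proof -
    have "prob (X i -` {b} \<inter> space M) = measure (distr M (count_space UNIV) (X i)) {b}"
      by (rule measure_distr[symmetric]) (auto intro: rv that)
    then show ?thesis
      by (simp add: unif[OF that] measure_uniform_count_measure)
  qed
  define ev where "ev g = {\<omega> \<in> space M. (\<lambda>i\<in>I. X (h i) \<omega>) = g}" for g
  \<comment> \<open>Over an empty index set the intersection would be the whole type instead of
    \<open>space M\<close>.\<close>
  have ev_eq: "ev g = (\<Inter>j\<in>h ` I. X j -` {g (the_inv_into I h j)} \<inter> space M)"
    if "g \<in> I \<rightarrow>\<^sub>E UNIV" for g
  proof -
    have "(\<lambda>i\<in>I. X (h i) \<omega>) = g \<longleftrightarrow> (\<forall>i\<in>I. X (h i) \<omega> = g i)" for \<omega>
      using that by (auto simp: fun_eq_iff PiE_def extensional_def)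
    then show ?thesis
      using I(2) by (auto simp: ev_def the_inv_into_f_f[OF h(1)])
  qed
  have ev_sets: "ev g \<in> events" if "g \<in> E" for g
    using that E I h(2) unfolding ev_eq[OF subsetD[OF E that]]
    by (intro sets.finite_INT measurable_sets[OF rv]) auto
  have ev_prob: "prob (ev g) = (1 / CARD('b)) ^ card I" if "g \<in> E" for g
  proof -
    have "prob (ev g) = (\<Prod>j\<in>h ` I. prob (X j -` {g (the_inv_into I h j)} \<inter> space M))"
      unfolding ev_eq[OF subsetD[OF E that]] using I h by (intro indep_varsD[OF indep]) auto
    also have "\<dots> = (\<Prod>j\<in>h ` I. 1 / CARD('b))"
      using h(2) by (intro prod.cong single) auto
    finally show ?thesis
      by (simp add: card_image[OF h(1)])
  qed
  have finE: "finite E"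
    using E by (rule finite_subset) (auto intro!: finite_PiE I)
  have Un: "{\<omega> \<in> space M. (\<lambda>i\<in>I. X (h i) \<omega>) \<in> E} = (\<Union>g\<in>E. ev g)"
    by (auto simp: ev_def)
  show "{\<omega> \<in> space M. (\<lambda>i\<in>I. X (h i) \<omega>) \<in> E} \<in> events"
    unfolding Un using finE ev_sets by auto
  have "prob (\<Union>g\<in>E. ev g) = (\<Sum>g\<in>E. prob (ev g))"
    using finE ev_sets by (intro finite_measure_finite_Union) (auto simp: disjoint_family_on_def ev_def)
  then show "prob {\<omega> \<in> space M. (\<lambda>i\<in>I. X (h i) \<omega>) \<in> E} = card E / real CARD('b) ^ card I"
    unfolding Un by (simp add: ev_prob power_one_over)
qed

text \<open>Pointwise form of the tail-sum formula, with the sum over times from 1 shifted to start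
  at 0. For an infinite \<open>e\<close> the partial sums are unbounded.\<close>

lemma ennreal_of_enat_eq_suminf:
  "ennreal_of_enat e = (\<Sum>t. if enat (Suc t) \<le> e then 1 else 0)"
proof -
  have "(\<lambda>t::nat. if t < e then 1 else 0) sums ennreal_of_enat e"
    using sums_If_finite[of "\<lambda>r. r < e" "\<lambda>_. 1 :: ennreal"]
    by (cases e) (simp_all add: sums_def of_nat_tendsto_top_ennreal)
  then show ?thesis
    by (simp add: sums_iff Suc_ile_eq)
qed

text \<open>The binomial expansion cancels the constant 1 and leaves finitely many geometric series
  with ratios \<open>1 / q ^ k\<close>.\<close>

lemma sums_one_minus_power:
  fixes q :: real
  assumes "1 < q"
  shows "(\<lambda>t. 1 - (1 - 1 / q ^ Suc t) ^ m) sums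
    (\<Sum>k=1..m. (- 1) ^ (k - 1) * real (m choose k) * (1 / (q ^ k - 1)))"
proof -
  have expand: "1 - (1 - x) ^ m = (\<Sum>k=1..m. (- 1) ^ (k - 1) * real (m choose k) * x ^ k)" for x :: real
  proof -
    have "(1 - x) ^ m = (\<Sum>k\<le>m. real (m choose k) * (- x) ^ k)"
      using binomial_ring[of "- x" 1 m] by simp
    also have "\<dots> = 1 + (\<Sum>k=1..m. real (m choose k) * (- x) ^ k)"
      by (simp add: atMost_atLeast0 sum.atLeast_Suc_atMost)
    also have "(\<Sum>k=1..m. real (m choose k) * (- x) ^ k)
        = - (\<Sum>k=1..m. (- 1) ^ (k - 1) * real (m choose k) * x ^ k)"
      unfolding sum_negf[symmetric]
    proof (rule sum.cong)
      fix k assume "k \<in> {1..m}"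
      then obtain l where "k = Suc l"
        by (cases k) auto
      then show "real (m choose k) * (- x) ^ k = - ((- 1) ^ (k - 1) * real (m choose k) * x ^ k)"
        by (simp add: power_minus[of x])
    qed simp
    finally show ?thesis
      by simp
  qed
  have geo: "(\<lambda>t. (1 / q ^ Suc t) ^ k) sums (1 / (q ^ k - 1))" if "k \<in> {1..m}" for k
  proof -
    have "1 < q ^ k"
      using that assms by (intro one_less_power) auto
    then have "(\<lambda>t. (1 / q ^ k) * (1 / q ^ k) ^ t) sums ((1 / q ^ k) * (1 / (1 - 1 / q ^ k)))"
      by (intro sums_mult geometric_sums) auto
    moreover have "(1 / q ^ k) * (1 / (1 - 1 / q ^ k)) = 1 / (q ^ k - 1)"
      using \<open>1 < q ^ k\<close> assms by (simp add: field_simps)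
    moreover have "(1 / q ^ k) * (1 / q ^ k) ^ t = (1 / q ^ Suc t) ^ k" for t
      by (simp add: power_one_over mult.commute power_mult_distrib flip: power_mult)
    ultimately show ?thesis
      by simp
  qed
  show ?thesis
    unfolding expand by (intro sums_sum sums_mult geo)
qed

text \<open>The cases \<open>2 \<le> m\<close> and \<open>m = 1\<close> are separated because for a
  single row the bound holds with equality, so the strict inequality is false there.\<close>

theorem mainTheorem3:
  fixes M :: "'w measure"
    and X :: "nat \<Rightarrow> nat \<Rightarrow> nat \<Rightarrow> 'w \<Rightarrow> 'a::{field, finite}"
    and m n :: nat
    and S :: "nat set"
  assumes "1 \<le> m" and "m \<le> n"
    and "prob_space M"
    and "prob_space.indep_vars M (\<lambda>_. count_space UNIV) (\<lambda>(t, i, j). X t i j)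
           (UNIV \<times> {..<m} \<times> {..<n})"
    and "\<And>t i j. i < m \<Longrightarrow> j < n \<Longrightarrow>
           distr M (count_space UNIV) (X t i j) = uniform_count_measure UNIV"
    and "S \<in> sinks m n"
  shows "(\<integral>\<^sup>+\<omega>. mean_decoding_time m n (\<lambda>t i j. X t i j \<omega>) \<partial>M)
           = (\<integral>\<^sup>+\<omega>. ennreal_of_enat (decoding_time m n (\<lambda>t i j. X t i j \<omega>) S) \<partial>M)
    \<and> (\<integral>\<^sup>+\<omega>. ennreal_of_enat (decoding_time m n (\<lambda>t i j. X t i j \<omega>) S) \<partial>M)
           = (\<Sum>t. emeasure M {\<omega> \<in> space M. enat (Suc t) \<le> decoding_time m n (\<lambda>t i j. X t i j \<omega>) S})
    \<and> (2 \<le> m \<longrightarrow>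
         (\<Sum>t. emeasure M {\<omega> \<in> space M. enat (Suc t) \<le> decoding_time m n (\<lambda>t i j. X t i j \<omega>) S})
           < ennreal (\<Sum>t. 1 - (1 - 1 / real CARD('a) ^ Suc t) ^ m))
    \<and> (m = 1 \<longrightarrow>
         (\<Sum>t. emeasure M {\<omega> \<in> space M. enat (Suc t) \<le> decoding_time m n (\<lambda>t i j. X t i j \<omega>) S})
           = ennreal (\<Sum>t. 1 - (1 - 1 / real CARD('a) ^ Suc t) ^ m))
    \<and> (\<lambda>t. 1 - (1 - 1 / real CARD('a) ^ Suc t) ^ m) sums
         (\<Sum>k=1..m. (- 1) ^ (k - 1) * real (m choose k) * (1 / (real CARD('a) ^ k - 1)))"
proof -
  interpret prob_space M
    by fact
  let ?T = "\<lambda>R \<omega>. decoding_time m n (\<lambda>t i j. X t i j \<omega>) R"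
  let ?P = "stuck_prob TYPE('a) m"
  let ?b = "\<lambda>t. 1 - (1 - 1 / real CARD('a) ^ Suc t) ^ m"
  define F where "F R t = {\<omega> \<in> space M. enat (Suc t) \<le> ?T R \<omega>}" for R t
  have F: "F R t \<in> events" "emeasure M (F R t) = ennreal (?P t)" if R: "R \<in> sinks m n" for R t
  proof -
    let ?I = "{..t} \<times> {..<m} \<times> {..<m}" and ?J = "UNIV \<times> {..<m} \<times> {..<n}"
    \<comment> \<open>Column \<open>j\<close> of the square matrix reads the draws of the
      \<open>j\<close>-th parent of \<open>R\<close> in increasing order.\<close>
    define h where "h = (\<lambda>(s :: nat, i :: nat, j). (s, i, pick R j))"
    have card: "card R = m" and sub: "R \<subseteq> {..<n}"
      using R by (auto simp: sinks_def)
    have pick: "pick R j < n" if "j < m" for j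
      using pick_in_set_le[of j R] that card sub by auto
    have "inj_on (pick R) {..<m}"
      using pick_mono_le[of _ R] by (intro linorder_inj_onI) (force simp: card)+
    then have inj: "inj_on h ?I"
      by (auto simp: inj_on_def h_def)
    have hJ: "h ` ?I \<subseteq> ?J"
      by (auto simp: h_def pick)
    have eq: "F R t = {\<omega> \<in> space M. (\<lambda>x\<in>?I. (case h x of (t, i, j) \<Rightarrow> X t i j) \<omega>) \<in> stuck m t}"
      unfolding F_def Suc_le_decoding_time_iff_stuck[OF R]
      by (intro Collect_cong conj_cong refl arg_cong2[where f = "(\<in>)"]) (auto simp: h_def)
    have ne: "?I \<noteq> {}"
      using assms(1) by (auto simp: lessThan_empty_iff)
    have unif: "distr M (count_space UNIV) (case x of (t, i, j) \<Rightarrow> X t i j) = uniform_count_measure UNIV"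
      if "x \<in> ?J" for x
      using that assms(5) by auto
    have st: "stuck m t \<subseteq> ?I \<rightarrow>\<^sub>E (UNIV :: 'a set)"
      by (auto simp: stuck_def)
    note p = prob_uniform_family[OF assms(4) unif _ ne inj hJ st]
    show "F R t \<in> events"
      unfolding eq by (rule p(1)) auto
    show "emeasure M (F R t) = ennreal (?P t)"
      unfolding emeasure_eq_measure eq stuck_prob_def by (subst p(2)) auto
  qed
  have T: "ennreal_of_enat (?T R \<omega>) = (\<Sum>t. indicator (F R t) \<omega>)" if "\<omega> \<in> space M" for R \<omega>
    using that by (simp add: ennreal_of_enat_eq_suminf F_def indicator_def of_bool_def)
  \<comment> \<open>Measurability comes from the series of indicators in \<open>T\<close>.\<close>
  have meas: "(\<lambda>\<omega>. ennreal_of_enat (?T R \<omega>)) \<in> borel_measurable M" if "R \<in> sinks m n" for R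
    using F(1)[OF that] by (subst measurable_cong[OF T]) auto
  have mean: "(\<integral>\<^sup>+\<omega>. ennreal_of_enat (?T R \<omega>) \<partial>M) = (\<Sum>t. emeasure M (F R t))" if "R \<in> sinks m n" for R
  proof -
    have "(\<integral>\<^sup>+\<omega>. ennreal_of_enat (?T R \<omega>) \<partial>M) = (\<integral>\<^sup>+\<omega>. (\<Sum>t. indicator (F R t) \<omega>) \<partial>M)"
      by (intro nn_integral_cong T)
    also have "\<dots> = (\<Sum>t. emeasure M (F R t))"
      using F(1)[OF that] by (simp add: nn_integral_suminf)
    finally show ?thesis .
  qed
  \<comment> \<open>Both tail sums are series of \<open>?P t\<close>, in which the sink does not
    occur.\<close>
  have same: "(\<integral>\<^sup>+\<omega>. ennreal_of_enat (?T R \<omega>) \<partial>M) = (\<integral>\<^sup>+\<omega>. ennreal_of_enat (?T S \<omega>) \<partial>M)"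
    if "R \<in> sinks m n" for R
    using that assms(6) by (simp add: mean F)
  have card_sinks: "card (sinks m n) = n choose m"
    using n_subsets[of "{..<n}" m] by (simp add: sinks_def)
  have "(\<integral>\<^sup>+\<omega>. mean_decoding_time m n (\<lambda>t i j. X t i j \<omega>) \<partial>M)
      = (\<Sum>R\<in>sinks m n. \<integral>\<^sup>+\<omega>. ennreal_of_enat (?T R \<omega>) \<partial>M) / of_nat (n choose m)"
    unfolding mean_decoding_time_def
    using meas by (subst nn_integral_divide, intro borel_measurable_sum)
      (simp_all only: nn_integral_sum)
  also have "\<dots> = of_nat (n choose m) * (\<integral>\<^sup>+\<omega>. ennreal_of_enat (?T S \<omega>) \<partial>M) / of_nat (n choose m)"
    by (simp add: same card_sinks)
  also have "\<dots> = (\<integral>\<^sup>+\<omega>. ennreal_of_enat (?T S \<omega>) \<partial>M)"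
    \<comment> \<open>Cancelling in \<open>ennreal\<close> needs a nonzero finite divisor;
      \<open>m \<le> n\<close> makes the binomial coefficient nonzero.\<close>
    using assms(2) by (subst mult.commute, intro mult_divide_eq_ennreal) auto
  finally have average: "(\<integral>\<^sup>+\<omega>. mean_decoding_time m n (\<lambda>t i j. X t i j \<omega>) \<partial>M)
      = (\<integral>\<^sup>+\<omega>. ennreal_of_enat (?T S \<omega>) \<partial>M)" .

  have sums: "?b sums (\<Sum>k=1..m. (- 1) ^ (k - 1) * real (m choose k) * (1 / (real CARD('a) ^ k - 1)))"
    using CARD_field_ge_2[where ?'a = 'a] by (intro sums_one_minus_power) simp
  have P_nonneg: "0 \<le> ?P t" for t
    by (simp add: stuck_prob_def)
  have P_le: "?P t \<le> ?b t" for t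
    by (rule stuck_prob_le)
  \<comment> \<open>Comparison with the bounding series makes the expectation finite, so that the
    strict inequality can be proved for real series and transferred to
    \<open>ennreal\<close>.\<close>
  have summable: "summable ?P"
    using P_nonneg P_le by (intro summable_comparison_test'[OF sums_summable[OF sums]]) simp
  have tail: "(\<Sum>t. emeasure M (F S t)) = ennreal (\<Sum>t. ?P t)"
    using F(2)[OF assms(6)] P_nonneg summable by (simp add: suminf_ennreal2)
  have strict: "(\<Sum>t. ?P t) < (\<Sum>t. ?b t)" if "2 \<le> m"
  proof -
    have "0 < (\<Sum>t. ?b t - ?P t)"
      using summable_diff[OF sums_summable[OF sums] summable] stuck_prob_less[OF that, where ?'a = 'a]
      by (intro suminf_pos) auto
    then show ?thesis
      unfolding suminf_diff[OF sums_summable[OF sums] summable, symmetric] by linarith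
  qed
  have tail_less: "(\<Sum>t. emeasure M (F S t)) < ennreal (\<Sum>t. ?b t)" if "2 \<le> m"
    unfolding tail using strict[OF that] suminf_nonneg[OF summable P_nonneg]
    by (simp add: ennreal_less_iff)
  have tail_eq: "(\<Sum>t. emeasure M (F S t)) = ennreal (\<Sum>t. ?b t)" if "m = 1"
  proof -
    have "?P = ?b"
      unfolding that stuck_prob_1 by simp
    then show ?thesis
      by (simp only: tail)
  qed
  show ?thesis
    using average mean[OF assms(6)] tail_less tail_eq sums unfolding F_def by blast
qed

end
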